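(* For every integer $N\ge4$ there exists $\alpha_N<1$ such that $$\Psi_N(\alpha)>\frac{(\alpha+2)^2}{8\alpha}$$ for every $\alpha\in(0,2)$ with $\alpha\ge\alpha_N$.
   Context: For $N\ge4$ and $1\le i,j\le N$ let $r_{ij}=\frac{2}{\sqrt N}\sin\left(\frac{|i-j|}{N}\pi\right)$, the mutual distances of the vertices of a regular $N$-gon inscribed in a circle of radius $1/\sqrt N$ (equal masses $1$). For $\alpha\in[0,2]$ define $a_{ij}=a_{ij}(\alpha)$ by $a_{ii}=\sum_{k\ne i}r_{ik}^{-(\alpha+2)}$ and $a_{ij}=-r_{ij}^{-(\alpha+2)}$ for $i\neq j$. Let $w\in\mathbb R^N$ be $w=(1/2,-1/2,1/2,-1/2)$ if $N=4$ and $w=(1/\sqrt2,-1/\sqrt2,0,\dots,0)$ if $N\ge5$. Define $$\Psi_N(\alpha)=\frac2N\,\frac{\sum_{i,j=1}^Na_{ij}w_iw_j}{\sum_{k=2}^Nr_{1k}^{-\alpha}} .$$ *)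

theory Defs
  imports "HOL-Analysis.Analysis"
begin

text \<open>
  Throughout, \<open>N\<close> is a natural number and vectors and matrices are functions of indices
  ranging over \<open>{1..N}\<close>; values at other indices are never used.
\<close>

definition rdist :: "nat \<Rightarrow> nat \<Rightarrow> nat \<Rightarrow> real" where
  "rdist N i j = 2 / sqrt (real N) * sin (\<bar>real i - real j\<bar> / real N * pi)"

definition amat :: "nat \<Rightarrow> real \<Rightarrow> nat \<Rightarrow> nat \<Rightarrow> real" where
  "amat N \<alpha> i j =
     (if i = j then (\<Sum>k\<in>{1..N} - {i}. rdist N i k powr (- (\<alpha> + 2)))
      else - (rdist N i j powr (- (\<alpha> + 2))))"

definition wvec :: "nat \<Rightarrow> nat \<Rightarrow> real" where
  "wvec N i =
     (if N = 4 then (if i \<in> {1, 3} then 1 / 2 else if i \<in> {2, 4} then - 1 / 2 else 0)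
      else (if i = 1 then 1 / sqrt 2 else if i = 2 then - 1 / sqrt 2 else 0))"

definition Psi :: "nat \<Rightarrow> real \<Rightarrow> real" where
  "Psi N \<alpha> =
     2 / real N *
     ((\<Sum>i\<in>{1..N}. \<Sum>j\<in>{1..N}. amat N \<alpha> i j * wvec N i * wvec N j) /
      (\<Sum>k\<in>{2..N}. rdist N 1 k powr (- \<alpha>)))"

end

theory Submission
  imports Defs
begin

text \<open>
  The statement holds with \<open>\<alpha>\<^sub>N = 9 / 10\<close> for every \<open>N\<close>. On \<open>[9 / 10, 2)\<close> the right-hand side
  \<open>(\<alpha> + 2)\<^sup>2 / (8 * \<alpha>)\<close> is decreasing and stays below \<open>117 / 100\<close> (\<open>rhs_less\<close>), so it is enough
  to bound \<open>Psi N \<alpha>\<close> below by that number.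

  Let \<open>s\<^sub>d = sin (d * pi / N)\<close>, let \<open>y\<^sub>d\<close> be the \<open>- \<alpha>\<close>-th power of the \<open>d\<close>-th chord of the polygon,
  and put \<open>u\<^sub>d = 1 / s\<^sub>d\<^sup>2\<close>. Since the distances depend on the difference of indices only, for
  \<open>N \<ge> 5\<close> the definition reduces to
  \<open>2 * Psi N \<alpha> = ((\<Sum>d. y\<^sub>d * u\<^sub>d) + y\<^sub>1 * u\<^sub>1) / (\<Sum>d. y\<^sub>d)\<close>, the sums being over \<open>0 < d < N\<close> and the
  extra term being added once. For \<open>\<mu> \<ge> 1\<close>, the numerator minus \<open>\<mu>\<close> times the denominator
  has the term \<open>y\<^sub>1 * (3 * u\<^sub>1 - 2 * \<mu>)\<close> from \<open>d = 1\<close>, \<open>d = N - 1\<close> and the extra summand, and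
  \<open>N - 3\<close> further terms \<open>y\<^sub>d * (u\<^sub>d - \<mu>)\<close>. The latter are at least \<open>y\<^sub>1 * (1 - \<mu>)\<close>,
  because \<open>u\<^sub>d \<ge> 1\<close> and because the side is the shortest chord, so that \<open>y\<^sub>d \<le> y\<^sub>1\<close>. With
  \<open>u\<^sub>1 \<ge> (N / pi)\<^sup>2\<close>, everything reduces to a quadratic inequality in \<open>N\<close>
  (\<open>Psi_gt_of_ge_5\<close>), which holds for \<open>N \<ge> 5\<close> and \<open>\<mu> = 117 / 50\<close>.

  For \<open>N = 4\<close> one has \<open>Psi 4 \<alpha> = 4 * y / (2 * y + 1)\<close> with \<open>y = y\<^sub>1 \<ge> 1\<close> (\<open>Psi_4\<close>), which is at
  least \<open>4 / 3\<close>.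
\<close>

section \<open>Chords of the regular polygon\<close>

text \<open>The distance between two vertices of the regular \<open>N\<close>-gon that are \<open>d\<close> steps apart.\<close>

definition chord :: "nat \<Rightarrow> nat \<Rightarrow> real" where
  "chord N d = 2 / sqrt (real N) * sin (real d * pi / real N)"

lemma rdist_chord:
  "i \<le> j \<Longrightarrow> rdist N i j = chord N (j - i)"
  by (simp add: rdist_def chord_def of_nat_diff)

lemma rdist_commute: "rdist N i j = rdist N j i"
  by (simp add: rdist_def abs_minus_commute)

lemma chord_reflect:
  assumes "0 < N" "d \<le> N"
  shows "chord N (N - d) = chord N d"
proof -
  have "real (N - d) * pi / real N = pi - real d * pi / real N"
    using assms by (simp add: of_nat_diff field_simps)
  then show ?thesis
    by (simp add: chord_def)
qed

lemma chord_pos: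
  assumes "0 < d" "d < N"
  shows "0 < chord N d"
proof -
  have "0 < sin (real d * pi / real N)"
    by (rule sin_gt_zero) (use assms in \<open>auto simp: field_simps\<close>)
  then show ?thesis
    using assms by (simp add: chord_def)
qed

lemma chord_one_le:
  assumes "0 < d" "d < N"
  shows "chord N 1 \<le> chord N d"
proof -
  \<comment> \<open>up to half of the polygon the sine is increasing; the rest follows by reflection\<close>
  have half: "chord N 1 \<le> chord N e" if e: "0 < e" "2 * e \<le> N" for e
  proof -
    have "sin (real 1 * pi / real N) \<le> sin (real e * pi / real N)"
    proof (rule sin_monotone_2pi_le)
      show "- (pi / 2) \<le> real 1 * pi / real N"
        by (rule order_trans[of _ 0]) auto
      show "real 1 * pi / real N \<le> real e * pi / real N"
        using e by (intro divide_right_mono mult_right_mono) auto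
      have "real e * 2 \<le> real N" using e by linarith
      then have "(real e * 2) * pi \<le> real N * pi"
        by (intro mult_right_mono) auto
      then show "real e * pi / real N \<le> pi / 2"
        using e by (simp add: field_simps)
    qed
    then show ?thesis
      unfolding chord_def by (intro mult_left_mono) auto
  qed
  show ?thesis
  proof (cases "2 * d \<le> N")
    case True
    then show ?thesis using half assms by blast
  next
    case False
    then have "chord N 1 \<le> chord N (N - d)"
      using half[of "N - d"] assms by simp
    then show ?thesis
      using chord_reflect[of N d] assms by simp
  qed
qed

text \<open>Rotational symmetry: the distances from any vertex run through all chords.\<close>

lemma sum_rdist_row:
  assumes "i \<in> {1..N}"
  shows "(\<Sum>k\<in>{1..N} - {i}. g (rdist N i k)) = (\<Sum>d\<in>{1..<N}. g (chord N d))"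
proof (rule sum.reindex_bij_witness[where
      i = "\<lambda>d. if i + d \<le> N then i + d else i + d - N" and
      j = "\<lambda>k. if i < k then k - i else N + k - i"])
  fix k assume k: "k \<in> {1..N} - {i}"
  show "g (chord N (if i < k then k - i else N + k - i)) = g (rdist N i k)"
  proof (cases "i < k")
    case True
    then show ?thesis by (simp add: rdist_chord)
  next
    case False
    then have ki: "k < i" "i - k \<le> N" "0 < N" "N + k - i = N - (i - k)"
      using k assms by auto
    then have "chord N (N + k - i) = rdist N i k"
      using chord_reflect[of N "i - k"] by (simp only: rdist_commute[of N i k] rdist_chord less_imp_le)
    then show ?thesis
      using False by simp
  qed
qed (use assms in auto)

lemma sum_rdist_first:
  assumes "0 < N"
  shows "(\<Sum>k\<in>{2..N}. g (rdist N 1 k)) = (\<Sum>d\<in>{1..<N}. g (chord N d))"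
proof -
  have "{2..N} = {1..N} - {1}" by auto
  then show ?thesis
    using sum_rdist_row[of 1 N g] assms by simp
qed

section \<open>Lower bounds for the quotient\<close>

lemma powr_minus_add_two:
  fixes x \<alpha> :: real
  assumes "0 < x"
  shows "x powr (- (\<alpha> + 2)) = x powr (- \<alpha>) / x ^ 2"
proof -
  have "x powr (- (\<alpha> + 2)) = x powr (- \<alpha>) * x powr (- 2)"
    by (simp flip: powr_add)
  also have "x powr (- 2) = 1 / x ^ 2"
    using assms by (simp add: powr_minus_divide)
  finally show ?thesis by simp
qed

lemma Psi_4:
  fixes \<alpha> y :: real
  defines "y \<equiv> chord 4 1 powr (- \<alpha>)"
  shows "Psi 4 \<alpha> = 4 * y / (2 * y + 1)"
proof -
  have c1: "(chord 4 1)\<^sup>2 = 1 / 2"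
    by (simp add: chord_def sin_45 power_divide)
  have c2: "chord 4 2 = 1"
    by (simp add: chord_def)
  have c3: "chord 4 3 = chord 4 1"
    using chord_reflect[of 4 1] by simp
  have y2: "chord 4 1 powr (- (\<alpha> + 2)) = 2 * y"
    using powr_minus_add_two[of "chord 4 1" \<alpha>] chord_pos[of 1 4] unfolding c1 by (simp add: y_def)
  have set4: "{1..4::nat} = {1, 2, 3, 4}" "{2..4::nat} = {2, 3, 4}" "{1..<4::nat} = {1, 2, 3}"
    by auto
  have diag: "amat 4 \<alpha> i i = 4 * y + 1" if "i \<in> {1..4}" for i
    using sum_rdist_row[OF that, of "\<lambda>r. r powr (- (\<alpha> + 2))"] y2
    unfolding amat_def set4 by (simp add: c2 c3)
  have off: "amat 4 \<alpha> i j = - (chord 4 (j - i) powr (- (\<alpha> + 2)))"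
    "amat 4 \<alpha> j i = - (chord 4 (j - i) powr (- (\<alpha> + 2)))" if "i < j" for i j
    using that by (simp_all add: amat_def rdist_chord rdist_commute[of 4 j i])
  have num: "(\<Sum>i\<in>{1..4}. \<Sum>j\<in>{1..4}. amat 4 \<alpha> i j * wvec 4 i * wvec 4 j) = 8 * y"
    using diag off y2 unfolding set4
    by (simp add: wvec_def c2 c3 field_simps)
  have den: "(\<Sum>k\<in>{2..4}. rdist 4 1 k powr (- \<alpha>)) = 2 * y + 1"
    using sum_rdist_first[of 4 "\<lambda>r. r powr (- \<alpha>)"] unfolding set4
    by (simp add: c2 c3 y_def)
  show ?thesis
    unfolding Psi_def using num den by simp
qed

text \<open>
  The test vector \<open>(1, -1, 0, \<dots>, 0) / sqrt 2\<close> gives \<open>(a\<^sub>1\<^sub>1 + a\<^sub>2\<^sub>2) / 2 - a\<^sub>1\<^sub>2\<close>, and the two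
  diagonal entries agree.
\<close>

lemma quadratic_form_ge_5:
  assumes "5 \<le> N"
  shows "(\<Sum>i\<in>{1..N}. \<Sum>j\<in>{1..N}. amat N \<alpha> i j * wvec N i * wvec N j) =
    (\<Sum>d\<in>{1..<N}. chord N d powr (- (\<alpha> + 2))) + chord N 1 powr (- (\<alpha> + 2))"
proof -
  have w0: "wvec N i = 0" if "i \<notin> {1, 2}" for i
    using that assms by (auto simp: wvec_def)
  have restrict: "(\<Sum>i\<in>{1..N}. f i) = f 1 + f 2" if "\<And>i. i \<notin> {1, 2} \<Longrightarrow> f i = 0" for f :: "nat \<Rightarrow> real"
  proof -
    have "(\<Sum>i\<in>{1..N}. f i) = (\<Sum>i\<in>{1, 2}. f i)"
      using assms that by (intro sum.mono_neutral_right) auto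
    then show ?thesis by simp
  qed
  have "(\<Sum>i\<in>{1..N}. \<Sum>j\<in>{1..N}. amat N \<alpha> i j * wvec N i * wvec N j) =
    (\<Sum>i\<in>{1..N}. amat N \<alpha> i 1 * wvec N i * wvec N 1 + amat N \<alpha> i 2 * wvec N i * wvec N 2)"
    by (intro sum.cong refl restrict) (simp add: w0)
  also have "\<dots> = (amat N \<alpha> 1 1 * wvec N 1 * wvec N 1 + amat N \<alpha> 1 2 * wvec N 1 * wvec N 2) +
    (amat N \<alpha> 2 1 * wvec N 2 * wvec N 1 + amat N \<alpha> 2 2 * wvec N 2 * wvec N 2)"
    by (rule restrict) (simp add: w0)
  also have "\<dots> = (amat N \<alpha> 1 1 + amat N \<alpha> 2 2) / 2 - (amat N \<alpha> 1 2 + amat N \<alpha> 2 1) / 2"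
    using assms by (simp add: wvec_def field_simps)
  also have "amat N \<alpha> 1 1 = (\<Sum>d\<in>{1..<N}. chord N d powr (- (\<alpha> + 2)))"
    using sum_rdist_row[of 1 N "\<lambda>r. r powr (- (\<alpha> + 2))"] assms by (simp add: amat_def)
  also have "amat N \<alpha> 2 2 = (\<Sum>d\<in>{1..<N}. chord N d powr (- (\<alpha> + 2)))"
    using sum_rdist_row[of 2 N "\<lambda>r. r powr (- (\<alpha> + 2))"] assms by (simp add: amat_def)
  also have "amat N \<alpha> 1 2 = - (chord N 1 powr (- (\<alpha> + 2)))"
    by (simp add: amat_def rdist_chord)
  also have "amat N \<alpha> 2 1 = - (chord N 1 powr (- (\<alpha> + 2)))"
    using rdist_commute[of N 2 1] rdist_chord[of 1 2 N] by (simp add: amat_def)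
  finally show ?thesis by simp
qed

text \<open>
  The hypothesis \<open>large\<close> is what remains of \<open>2 * Psi N \<alpha> > \<mu>\<close> when all terms are compared with
  the one belonging to the sides of the polygon; the exponent \<open>\<alpha>\<close> drops out of it.
\<close>

lemma Psi_gt_of_ge_5:
  fixes \<alpha> \<mu> :: real
  assumes N: "5 \<le> N" and \<alpha>: "0 \<le> \<alpha>" and \<mu>: "1 \<le> \<mu>"
    and large: "(real N - 1) * \<mu> < 3 * (real N / pi) ^ 2 + (real N - 3)"
  shows "\<mu> / 2 < Psi N \<alpha>"
proof -
  define y where "y d = chord N d powr (- \<alpha>)" for d
  \<comment> \<open>normalised so that \<open>u d\<close> is the squared cosecant of \<open>d * pi / N\<close>\<close>
  define u where "u d = 4 / (real N * (chord N d)\<^sup>2)" for d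
  have pos: "0 < chord N d" if "d \<in> {1..<N}" for d
    using that chord_pos by simp
  have ypos: "0 < y d" if "d \<in> {1..<N}" for d
    using pos[OF that] by (simp add: y_def)
  have y_le: "y d \<le> y 1" if "d \<in> {1..<N}" for d
    unfolding y_def
    using that \<alpha> pos[of 1] chord_one_le[of d N] N
    by (intro powr_mono2') auto
  have u_sin: "u d = 1 / (sin (real d * pi / real N))\<^sup>2" for d
    using N by (simp add: u_def chord_def power_mult_distrib power_divide)
  have sin_pos: "0 < sin (real d * pi / real N)" if "d \<in> {1..<N}" for d
    using pos[OF that] N by (simp add: chord_def zero_less_divide_iff)
  have u_ge: "1 \<le> u d" if "d \<in> {1..<N}" for d
    using sin_pos[OF that] by (simp add: u_sin divide_simps power_le_one)
  have u1: "(real N / pi)\<^sup>2 \<le> u 1"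
  proof -
    have s: "0 < sin (pi / real N)" using sin_pos[of 1] N by simp
    have "sin (pi / real N) \<le> pi / real N"
      using N by (intro sin_x_le_x) auto
    then have "(sin (pi / real N))\<^sup>2 \<le> (pi / real N)\<^sup>2"
      using s by (intro power_mono) auto
    then have "1 / (pi / real N)\<^sup>2 \<le> 1 / (sin (pi / real N))\<^sup>2"
      using s N by (intro divide_left_mono) auto
    then show ?thesis by (simp add: u_sin power_divide)
  qed
  have yu: "chord N d powr (- (\<alpha> + 2)) = real N / 4 * (y d * u d)" if "d \<in> {1..<N}" for d
    using powr_minus_add_two[OF pos[OF that], of \<alpha>] pos[OF that] N by (simp add: y_def u_def)
  define A where "A = (\<Sum>d\<in>{1..<N}. y d * u d) + y 1 * u 1"
  define B where "B = (\<Sum>d\<in>{1..<N}. y d)"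
  have Bpos: "0 < B"
    unfolding B_def using N ypos by (intro sum_pos) auto
  have split: "(\<Sum>d\<in>{1..<N}. f d) = f 1 + f (N - 1) + (\<Sum>d\<in>{2..<N-1}. f d)" for f :: "nat \<Rightarrow> real"
  proof -
    have "{1..<N} = insert 1 (insert (N - 1) {2..<N-1})" using N by auto
    moreover have "(1::nat) \<noteq> N - 1" using N by auto
    ultimately show ?thesis by simp
  qed
  have ends: "y (N - 1) = y 1" "u (N - 1) = u 1"
    using N by (simp_all add: y_def u_def chord_reflect)
  have "(\<Sum>d\<in>{2..<N-1}. y d * (u d - \<mu>)) \<ge> (\<Sum>d\<in>{2..<N-1}. y 1 * (1 - \<mu>))"
  proof (rule sum_mono)
    fix d assume "d \<in> {2..<N-1}"
    then have d: "d \<in> {1..<N}" by auto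
    have "y 1 * (1 - \<mu>) \<le> y d * (1 - \<mu>)"
      using y_le[OF d] \<mu> by (intro mult_right_mono_neg) auto
    also have "\<dots> \<le> y d * (u d - \<mu>)"
      using u_ge[OF d] ypos[OF d] by (intro mult_left_mono) auto
    finally show "y 1 * (1 - \<mu>) \<le> y d * (u d - \<mu>)" .
  qed
  then have mid: "(real N - 3) * (y 1 * (1 - \<mu>)) \<le> (\<Sum>d\<in>{2..<N-1}. y d * (u d - \<mu>))"
    using N by (simp add: of_nat_diff)
  have "A - \<mu> * B = (\<Sum>d\<in>{1..<N}. y d * (u d - \<mu>)) + y 1 * u 1"
    by (simp add: A_def B_def sum_distrib_left sum_subtractf algebra_simps)
  also have "\<dots> = y 1 * (3 * u 1 - 2 * \<mu>) + (\<Sum>d\<in>{2..<N-1}. y d * (u d - \<mu>))"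
    by (simp only: split ends) (simp add: algebra_simps)
  also have "\<dots> \<ge> y 1 * (3 * u 1 - 2 * \<mu>) + (real N - 3) * (y 1 * (1 - \<mu>))"
    using mid by simp
  also have "y 1 * (3 * u 1 - 2 * \<mu>) + (real N - 3) * (y 1 * (1 - \<mu>)) =
      y 1 * (3 * u 1 + (real N - 3) - (real N - 1) * \<mu>)"
    by (simp add: algebra_simps)
  finally have "y 1 * (3 * u 1 + (real N - 3) - (real N - 1) * \<mu>) \<le> A - \<mu> * B" .
  moreover have "0 < y 1 * (3 * u 1 + (real N - 3) - (real N - 1) * \<mu>)"
    using ypos[of 1] N large u1 by (intro mult_pos_pos) auto
  ultimately have "\<mu> < A / B"
    using Bpos by (simp add: field_simps)
  moreover have "Psi N \<alpha> = A / B / 2"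
  proof -
    have "(\<Sum>i\<in>{1..N}. \<Sum>j\<in>{1..N}. amat N \<alpha> i j * wvec N i * wvec N j) = real N / 4 * A"
    proof -
      have "(\<Sum>d\<in>{1..<N}. chord N d powr (- (\<alpha> + 2))) = (\<Sum>d\<in>{1..<N}. real N / 4 * (y d * u d))"
        by (rule sum.cong[OF refl]) (rule yu)
      moreover have "chord N 1 powr (- (\<alpha> + 2)) = real N / 4 * (y 1 * u 1)"
        by (rule yu) (use N in simp)
      ultimately show ?thesis
        by (simp only: quadratic_form_ge_5[OF N] A_def distrib_left sum_distrib_left)
    qed
    moreover have "(\<Sum>k\<in>{2..N}. rdist N 1 k powr (- \<alpha>)) = B"
      using sum_rdist_first[of N "\<lambda>r. r powr (- \<alpha>)"] N by (simp add: B_def y_def)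
    ultimately have "Psi N \<alpha> = 2 / real N * (real N / 4 * A / B)"
      by (simp only: Psi_def)
    then show ?thesis
      using N by simp
  qed
  ultimately show ?thesis by simp
qed

lemma rhs_less:
  fixes \<alpha> :: real
  assumes "9 / 10 \<le> \<alpha>" "\<alpha> < 2"
  shows "(\<alpha> + 2)^2 / (8 * \<alpha>) < 117 / 100"
proof -
  \<comment> \<open>The right-hand side below is \<open>500 * (117 / 100 * (8 * \<alpha>) - (\<alpha> + 2)\<^sup>2)\<close>.\<close>
  have "0 < (10 * \<alpha> - 9) * (223 - 50 * \<alpha>) + 7"
    using assms by (intro add_nonneg_pos mult_nonneg_nonneg) auto
  then have "(\<alpha> + 2)^2 < 117 / 100 * (8 * \<alpha>)"
    using assms by (simp add: power2_eq_square algebra_simps)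
  then show ?thesis using assms by (simp add: divide_less_eq)
qed

theorem theorem5p7:
  shows "\<forall>N::nat. N \<ge> 4 \<longrightarrow>
    (\<exists>\<alpha>\<^sub>N::real. \<alpha>\<^sub>N < 1 \<and>
      (\<forall>\<alpha>::real. 0 < \<alpha> \<and> \<alpha> < 2 \<and> \<alpha> \<ge> \<alpha>\<^sub>N \<longrightarrow>
        Psi N \<alpha> > (\<alpha> + 2)^2 / (8 * \<alpha>)))"
proof -
  have "117 / 100 < Psi N \<alpha>" if N: "4 \<le> N" and \<alpha>: "9 / 10 \<le> \<alpha>" for N and \<alpha> :: real
  proof (cases "N = 4")
    case True
    have "chord 4 1 \<le> 1"
      by (simp add: chord_def)
    then have "chord 4 1 powr \<alpha> \<le> 1"
      using \<alpha> chord_pos[of 1 4] by (intro powr_le1) auto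
    then have "1 \<le> chord 4 1 powr (- \<alpha>)"
      using chord_pos[of 1 4] by (simp add: powr_minus_divide)
    then show ?thesis
      by (simp add: True Psi_4 divide_simps)
  next
    case False
    then have N5: "5 \<le> N" using N by simp
    \<comment> \<open>At \<open>N = 5\<close> the required inequality needs \<open>pi\<close> below about \<open>3.19\<close>.\<close>
    have "pi \<le> 63 / 20" using pi_approx by simp
    then have "pi\<^sup>2 \<le> (63 / 20)\<^sup>2" by (intro power_mono) auto
    then have "(real N)\<^sup>2 / (63 / 20)\<^sup>2 \<le> (real N)\<^sup>2 / pi\<^sup>2"
      by (intro divide_left_mono) auto
    moreover have "5 * real N \<le> (real N)\<^sup>2"
      using N5 by (simp add: power2_eq_square)
    ultimately have "(real N - 1) * (117 / 50) < 3 * (real N / pi) ^ 2 + (real N - 3)"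
      using N5 by (simp add: power_divide)
    from Psi_gt_of_ge_5[OF N5 _ _ this, of \<alpha>] show ?thesis using \<alpha> by simp
  qed
  then have "\<forall>\<alpha>::real. 0 < \<alpha> \<and> \<alpha> < 2 \<and> \<alpha> \<ge> 9 / 10 \<longrightarrow> Psi N \<alpha> > (\<alpha> + 2)^2 / (8 * \<alpha>)"
    if "4 \<le> N" for N
    using that rhs_less by (meson less_trans)
  moreover have "(9 / 10 :: real) < 1" by simp
  ultimately show ?thesis by blast
qed

end
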